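(* Let $\hat\theta=\hat\theta_n\in\operatorname{argmin}_\theta f_n(\theta)$ and let $\hat\theta_{init}$ be a $\sqrt n$-consistent estimator of $\hat\theta$, where $f_n$ is such that $\hat\theta$ and a minimizer defining $\operatorname{prox}_{f_n}^{C_n}(\hat\theta_{init})$ exist almost surely. Assume: (i) $\lambda_{\max}(C_n)=o_P(1)$; (ii) there is a constant $L$ such that for each constant $M$, the function $\operatorname{prox}_{f_n}^{C_n}$ is $L$-Lipschitz continuous on $\{\theta:\|\theta-\hat\theta\|\le M/\sqrt n\}$ with high probability; (iii) there is a constant $m>0$ such that for each constant $M$, the function $f_n$ is strongly convex with modulus $m$ on $\{\theta:\|\theta-\hat\theta\|\le M/\sqrt n\}$ with high probability. Then the one-step estimator $$\hat\theta_{ose}=\hat\theta_{init}-C_n^{-1}\nabla e_{C_n}f_n(\hat\theta_{init}),$$ a single iteration of scaled gradient descent applied to the scaled Moreau envelope $e_{C_n}f_n$, is asymptotically equivalent to the estimator $\hat\theta$ which minimizes $f_n$.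
   Context: $\Theta\subseteq\mathbb{R}^d$ is open; $f_n:\Omega\times\Theta\to\mathbb{R}\cup\{\infty\}$ is a sequence of random functions on a probability space $(\Omega,\mathcal A,P)$ (dependence on $\Omega$ suppressed), regarded as functions on $\mathbb{R}^d$ with value $+\infty$ outside $\Theta$; $C_n$ is a sequence of random (symmetric) positive definite $d\times d$ matrices, with $\lambda_{\max}(C_n)$ the largest eigenvalue. Estimators are random vectors depending on $n$. For $f:\mathbb{R}^d\to\mathbb{R}\cup\{\infty\}$ and positive definite $C$, with $\|x\|_C^2=\langle x,Cx\rangle$, the scaled proximal operator and the scaled Moreau envelope are $$\operatorname{prox}_f^C(x)=\operatorname{argmin}_{w\in\mathbb{R}^d}\Big\{f(w)+\tfrac12\|w-x\|_C^2\Big\},\qquad e_Cf(x)=\inf_{w\in\mathbb{R}^d}\Big\{f(w)+\tfrac12\|x-w\|_C^2\Big\}.$$ Saying that the scaled proximal operator is Lipschitz continuous on a set includes that it is single-valued there. The formula for $\hat\theta_{ose}$ is used on the event that $e_{C_n}f_n$ is differentiable at $\hat\theta_{init}$; off this event $\hat\theta_{ose}$ may be given any value. An event depending on $n$ holds with high probability if for every $\epsilon>0$ its probability is at least $1-\epsilon$ for all sufficiently large $n$. $\hat\theta_{init}$ is $\sqrt n$-consistent for $\hat\theta$ if $\sqrt n(\hat\theta_{init}-\hat\theta)=O_P(1)$. Two estimators $\hat\theta,\tilde\theta$ are asymptotically equivalent if $\sqrt n\|\hat\theta-\tilde\theta\|=o_P(1)$. *)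

theory Defs
  imports "HOL-Probability.Probability"
begin

definition pos_def :: "real^'d^'d \<Rightarrow> bool" where
  "pos_def C \<longleftrightarrow> transpose C = C \<and> (\<forall>x. x \<noteq> 0 \<longrightarrow> 0 < x \<bullet> (C *v x))"

definition eigenvalues :: "real^'d^'d \<Rightarrow> real set" where
  "eigenvalues C = {l. \<exists>v. v \<noteq> 0 \<and> C *v v = l *\<^sub>R v}"

definition lambda_max :: "real^'d^'d \<Rightarrow> real" where
  "lambda_max C = Max (eigenvalues C)"

definition sqnorm_scaled :: "real^'d^'d \<Rightarrow> real^'d \<Rightarrow> real" where
  "sqnorm_scaled C x = x \<bullet> (C *v x)"

definition argmin :: "('a \<Rightarrow> ereal) \<Rightarrow> 'a set" where
  "argmin f = {x. is_arg_min f (\<lambda>_. True) x}"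

definition prox :: "(real^'d \<Rightarrow> ereal) \<Rightarrow> real^'d^'d \<Rightarrow> real^'d \<Rightarrow> (real^'d) set" where
  "prox f C x = argmin (\<lambda>w. f w + ereal (1/2 * sqnorm_scaled C (w - x)))"

definition moreau_env :: "(real^'d \<Rightarrow> ereal) \<Rightarrow> real^'d^'d \<Rightarrow> real^'d \<Rightarrow> ereal" where
  "moreau_env f C x = (INF w. f w + ereal (1/2 * sqnorm_scaled C (x - w)))"

text \<open>The proximal operator is a set of minimizers; being Lipschitz on \<open>S\<close> includes being
  single-valued on \<open>S\<close>.\<close>

definition prox_lipschitz_on ::
  "real \<Rightarrow> (real^'d) set \<Rightarrow> (real^'d \<Rightarrow> ereal) \<Rightarrow> real^'d^'d \<Rightarrow> bool" where
  "prox_lipschitz_on L S f C \<longleftrightarrow>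
     (\<exists>p. (\<forall>x\<in>S. prox f C x = {p x}) \<and> L-lipschitz_on S p)"

definition strongly_convex_on ::
  "real \<Rightarrow> (real^'d) set \<Rightarrow> (real^'d \<Rightarrow> ereal) \<Rightarrow> bool" where
  "strongly_convex_on m S f \<longleftrightarrow>
     (\<forall>x\<in>S. \<forall>y\<in>S. \<forall>t::real. 0 < t \<and> t < 1 \<longrightarrow>
        f ((1 - t) *\<^sub>R x + t *\<^sub>R y)
          \<le> ereal (1 - t) * f x + ereal t * f y - ereal (m/2 * t * (1 - t) * (norm (x - y))\<^sup>2))"

text \<open>An extended-real-valued function is differentiable at \<open>x\<close> with gradient \<open>v\<close> only if it is
  finite near \<open>x\<close>. The first conjunct is needed because \<^const>\<open>real_of_ereal\<close> maps
  infinite values to 0.\<close>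

definition has_gradient :: "(real^'d \<Rightarrow> ereal) \<Rightarrow> real^'d \<Rightarrow> real^'d \<Rightarrow> bool" where
  "has_gradient g x v \<longleftrightarrow>
     (\<forall>\<^sub>F y in nhds x. \<bar>g y\<bar> \<noteq> \<infinity>) \<and> GDERIV (\<lambda>y. real_of_ereal (g y)) x :> v"

text \<open>Events such as Lipschitz continuity of a random function on a random set need not be
  measurable, so probabilities are bounded below through measurable subsets (inner probability);
  this agrees with the usual meaning on measurable events.\<close>

definition prob_ge :: "'w measure \<Rightarrow> real \<Rightarrow> ('w \<Rightarrow> bool) \<Rightarrow> bool" where
  "prob_ge P p E \<longleftrightarrow> (\<exists>A\<in>sets P. (\<forall>w\<in>A. E w) \<and> p \<le> measure P A)"

lemma (in prob_space) prob_ge_iff: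
  assumes "{w \<in> space M. E w} \<in> events"
  shows "prob_ge M p E \<longleftrightarrow> p \<le> prob {w \<in> space M. E w}"
proof
  assume "prob_ge M p E"
  then obtain A where A: "A \<in> events" "\<forall>w\<in>A. E w" "p \<le> prob A"
    unfolding prob_ge_def by (elim bexE conjE)
  have "A \<subseteq> {w \<in> space M. E w}"
    using A(2) sets.sets_into_space[OF A(1)] by blast
  then have "prob A \<le> prob {w \<in> space M. E w}"
    by (rule finite_measure_mono[OF _ assms])
  with A(3) show "p \<le> prob {w \<in> space M. E w}"
    by linarith
next
  assume "p \<le> prob {w \<in> space M. E w}"
  then show "prob_ge M p E"
    unfolding prob_ge_def by (intro bexI[OF _ assms]) simp
qed

definition whp :: "'w measure \<Rightarrow> (nat \<Rightarrow> 'w \<Rightarrow> bool) \<Rightarrow> bool" where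
  "whp P E \<longleftrightarrow> (\<forall>\<epsilon>>0. \<forall>\<^sub>F n in sequentially. prob_ge P (1 - \<epsilon>) (E n))"

definition bigO_P1 :: "'w measure \<Rightarrow> (nat \<Rightarrow> 'w \<Rightarrow> 'a::real_normed_vector) \<Rightarrow> bool" where
  "bigO_P1 P X \<longleftrightarrow>
     (\<forall>\<epsilon>>0. \<exists>K. \<forall>\<^sub>F n in sequentially. prob_ge P (1 - \<epsilon>) (\<lambda>w. norm (X n w) \<le> K))"

definition smallo_P1 :: "'w measure \<Rightarrow> (nat \<Rightarrow> 'w \<Rightarrow> 'a::real_normed_vector) \<Rightarrow> bool" where
  "smallo_P1 P X \<longleftrightarrow> (\<forall>\<delta>>0. whp P (\<lambda>n w. norm (X n w) \<le> \<delta>))"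

definition sqrt_n_consistent ::
  "'w measure \<Rightarrow> (nat \<Rightarrow> 'w \<Rightarrow> real^'d) \<Rightarrow> (nat \<Rightarrow> 'w \<Rightarrow> real^'d) \<Rightarrow> bool" where
  "sqrt_n_consistent P X Y \<longleftrightarrow> bigO_P1 P (\<lambda>n w. sqrt (real n) *\<^sub>R (X n w - Y n w))"

definition asymp_equivalent ::
  "'w measure \<Rightarrow> (nat \<Rightarrow> 'w \<Rightarrow> real^'d) \<Rightarrow> (nat \<Rightarrow> 'w \<Rightarrow> real^'d) \<Rightarrow> bool" where
  "asymp_equivalent P X Y \<longleftrightarrow> smallo_P1 P (\<lambda>n w. sqrt (real n) * norm (X n w - Y n w))"

end

theory Submission imports Defs begin

text \<open>
  The proof is deterministic apart from bookkeeping of events. Fix an outcome on which the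
  hypotheses hold on a ball around the minimizer \<open>a\<close> of \<open>f\<close> and the initial value \<open>x\<close> lies inside
  that ball.

  \<^item> The one-step estimator is a proximal point. A single-valued Lipschitz proximal map \<open>p\<close> forces
    the Moreau envelope to be differentiable with gradient \<open>C (x - p x)\<close>
    (\<open>moreau_env_has_gradient\<close>), so \<open>x - C\<^sup>-\<^sup>1 C (x - p x) = p x\<close>.

  \<^item> The proximal point is near \<open>a\<close>. Since \<open>a\<close> minimizes \<open>f\<close>, it is a fixed point of \<open>p\<close>, so the
    Lipschitz bound keeps \<open>p x\<close> in a ball of radius of order \<open>1 / \<surd>n\<close>, where strong convexity is
    available. There \<open>f\<close> grows quadratically away from \<open>a\<close>, whereas passing from \<open>a\<close> to \<open>p x\<close>
    raises \<open>f\<close> by at most the penalty \<open>\<parallel>a - x\<parallel>\<^sub>C\<^sup>2 / 2\<close>. Comparing the two and bounding the penalty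
    through the largest eigenvalue gives \<open>m \<parallel>p x - a\<parallel>\<^sup>2 \<le> 2 \<lambda>\<^sub>m\<^sub>a\<^sub>x \<parallel>x - a\<parallel>\<^sup>2\<close>
    (\<open>one_step_error_bound\<close>).

  Multiplied by \<open>n\<close>, the right-hand side is \<open>o\<^sub>P(1) O\<^sub>P(1)\<close>.
\<close>

section \<open>Quadratic forms and the largest eigenvalue\<close>

lemma inner_symmetric_matrix:
  fixes C :: "real^'d^'d"
  assumes "transpose C = C"
  shows "x \<bullet> (C *v y) = y \<bullet> (C *v x)"
  by (metis assms dot_lmul_matrix inner_commute transpose_matrix_vector)

lemma sqnorm_scaled_add:
  fixes C :: "real^'d^'d"
  assumes "transpose C = C"
  shows "sqnorm_scaled C (u + v) = sqnorm_scaled C u + 2 * (v \<bullet> (C *v u)) + sqnorm_scaled C v"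
  using inner_symmetric_matrix[OF assms, of u v]
  by (simp add: sqnorm_scaled_def matrix_vector_right_distrib inner_add_left inner_add_right)

lemma sqnorm_scaled_scaleR:
  "sqnorm_scaled C (c *\<^sub>R x) = c\<^sup>2 * sqnorm_scaled C x"
  by (simp add: sqnorm_scaled_def matrix_vector_mult_scaleR power2_eq_square)

lemma sqnorm_scaled_minus_commute:
  "sqnorm_scaled C (x - y) = sqnorm_scaled C (y - x)"
  using sqnorm_scaled_scaleR[of C "-1" "x - y"] by simp

lemma sqnorm_scaled_0 [simp]: "sqnorm_scaled C 0 = 0"
  by (simp add: sqnorm_scaled_def)

text \<open>Eigenvectors for distinct eigenvalues are orthogonal, hence linearly independent. The maximum
  in the definition of \<^const>\<open>lambda_max\<close> is therefore over a finite set.\<close>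

lemma finite_eigenvalues_symmetric:
  fixes C :: "real^'d^'d"
  assumes sym: "transpose C = C"
  shows "finite (eigenvalues C)"
proof -
  define ev where "ev l = (SOME v. v \<noteq> 0 \<and> C *v v = l *\<^sub>R v)" for l
  have ev: "ev l \<noteq> 0 \<and> C *v ev l = l *\<^sub>R ev l" if "l \<in> eigenvalues C" for l
    using that someI_ex[of "\<lambda>v. v \<noteq> 0 \<and> C *v v = l *\<^sub>R v"]
    by (auto simp: eigenvalues_def ev_def)
  have orth: "ev l \<bullet> ev k = 0" if "l \<in> eigenvalues C" "k \<in> eigenvalues C" "l \<noteq> k" for l k
    using inner_symmetric_matrix[OF sym, of "ev l" "ev k"] ev[OF that(1)] ev[OF that(2)] that(3)
    by (simp add: inner_commute)
  have "inj_on ev (eigenvalues C)"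
    by (rule inj_onI) (metis ev orth inner_eq_zero_iff)
  moreover have "independent (ev ` eigenvalues C)"
    using ev orth
    by (intro pairwise_orthogonal_independent) (auto simp: pairwise_def orthogonal_def)
  then have "finite (ev ` eigenvalues C)"
    by (rule independent_imp_finite)
  ultimately show ?thesis
    using finite_imageD by blast
qed

text \<open>If a nonnegative quadratic form vanishes at \<open>v\<close>, then \<open>v\<close> minimizes it, and the first-order
  condition at \<open>v\<close> puts \<open>v\<close> into the kernel.\<close>

lemma psd_isotropic_imp_kernel:
  fixes B :: "real^'d^'d"
  assumes sym: "transpose B = B" and psd: "\<And>x. 0 \<le> sqnorm_scaled B x"
    and v: "sqnorm_scaled B v = 0"
  shows "B *v v = 0"
proof -
  define w where "w = B *v v"
  define c where "c = sqnorm_scaled B w"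
  have c: "0 \<le> c"
    using psd by (simp add: c_def)
  have "w \<bullet> w = 0"
  proof (rule ccontr)
    assume "w \<bullet> w \<noteq> 0"
    then have ww: "0 < w \<bullet> w"
      by simp
    \<comment> \<open>a step along \<open>- w\<close> so short that the linear term outweighs the quadratic one\<close>
    define t where "t = (w \<bullet> w) / (c + 1)"
    have t: "0 < t"
      using ww c by (simp add: t_def)
    have "0 \<le> sqnorm_scaled B (v + (- t) *\<^sub>R w)"
      by (rule psd)
    also have "\<dots> = t * (t * c - 2 * (w \<bullet> w))"
      unfolding sqnorm_scaled_add[OF sym] sqnorm_scaled_scaleR v
      by (simp add: c_def[symmetric] w_def[symmetric] power2_eq_square algebra_simps)
    finally have "2 * (w \<bullet> w) \<le> t * c"
      using t by (simp add: zero_le_mult_iff)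
    also have "\<dots> \<le> w \<bullet> w"
      using c ww by (simp add: t_def field_simps)
    finally show False
      using ww by simp
  qed
  then show ?thesis
    by (simp add: w_def)
qed

text \<open>The maximum of the Rayleigh quotient on the compact unit sphere is attained and is itself an
  eigenvalue, so it is at most \<^const>\<open>lambda_max\<close>.\<close>

lemma sqnorm_scaled_le_lambda_max:
  fixes C :: "real^'d^'d"
  assumes sym: "transpose C = C"
  shows "sqnorm_scaled C x \<le> lambda_max C * (norm x)\<^sup>2"
proof -
  have "continuous_on (sphere 0 1) (sqnorm_scaled C)"
    unfolding sqnorm_scaled_def
    by (intro continuous_intros linear_continuous_on_compose[OF _ matrix_vector_mul_linear])
  moreover have "sphere (0 :: real^'d) 1 \<noteq> {}"
    by simp
  ultimately obtain v :: "real^'d" where v: "norm v = 1"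
      and max: "\<And>y. norm y = 1 \<Longrightarrow> sqnorm_scaled C y \<le> sqnorm_scaled C v"
    using continuous_attains_sup[OF compact_sphere] by (metis mem_sphere_0)
  define \<mu> where "\<mu> = sqnorm_scaled C v"
  have bound: "sqnorm_scaled C y \<le> \<mu> * (norm y)\<^sup>2" for y
  proof (cases "y = 0")
    case False
    then have "sqnorm_scaled C ((1 / norm y) *\<^sub>R y) \<le> \<mu>"
      unfolding \<mu>_def by (intro max) simp
    then show ?thesis
      using False by (simp add: sqnorm_scaled_scaleR field_simps)
  qed simp
  define B where "B = \<mu> *\<^sub>R mat 1 - C"
  have Bv: "B *v y = \<mu> *\<^sub>R y - C *v y" for y
    by (simp add: B_def matrix_vector_mult_diff_rdistrib scaleR_matrix_vector_assoc[symmetric])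
  have Bq: "sqnorm_scaled B y = \<mu> * (norm y)\<^sup>2 - sqnorm_scaled C y" for y
    by (simp add: sqnorm_scaled_def Bv inner_diff_right power2_norm_eq_inner)
  have "transpose B = B"
    using sym by (simp add: B_def transpose_def vec_eq_iff mat_def)
  then have "B *v v = 0"
    by (rule psd_isotropic_imp_kernel) (use bound v in \<open>auto simp: Bq \<mu>_def\<close>)
  then have "\<mu> \<in> eigenvalues C"
    using v by (auto simp: eigenvalues_def Bv intro!: exI[of _ v])
  then have "\<mu> \<le> lambda_max C"
    unfolding lambda_max_def using finite_eigenvalues_symmetric[OF sym] by (rule Max_ge[rotated])
  then show ?thesis
    using bound[of x] by (meson mult_right_mono order_trans zero_le_power2)
qed

lemma pos_def_matrix_inv_mult:
  fixes C :: "real^'d^'d"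
  assumes "pos_def C"
  shows "matrix_inv C *v (C *v x) = x"
proof -
  have "\<forall>x. C *v x = 0 \<longrightarrow> x = 0"
    using assms unfolding pos_def_def by (metis inner_zero_right less_irrefl)
  then have "invertible C"
    by (metis invertible_left_inverse matrix_left_invertible_ker)
  then have "matrix_inv C ** C = mat 1"
    unfolding invertible_def matrix_inv_def by (rule someI2_ex) blast
  then show ?thesis
    by (simp add: matrix_vector_mul_assoc)
qed

section \<open>Proximal points and the Moreau envelope\<close>

lemma argmin_le: "a \<in> argmin f \<Longrightarrow> f a \<le> f y"
  by (auto simp: argmin_def is_arg_min_def not_less)

lemma prox_le:
  assumes "p \<in> prox f C x"
  shows "f p + ereal (1/2 * sqnorm_scaled C (p - x)) \<le> f w + ereal (1/2 * sqnorm_scaled C (w - x))"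
  using argmin_le[OF assms[unfolded prox_def]] .

lemma prox_finite:
  assumes "p \<in> prox f C x" and "f z \<noteq> \<infinity>" and "f p \<noteq> -\<infinity>"
  shows "\<bar>f p\<bar> \<noteq> \<infinity>"
  using prox_le[OF assms(1), of z] assms(2,3) by (cases "f p"; cases "f z") auto

lemma moreau_env_eq_prox:
  assumes "p \<in> prox f C x"
  shows "moreau_env f C x = f p + ereal (1/2 * sqnorm_scaled C (x - p))"
  unfolding moreau_env_def
  using prox_le[OF assms]
  by (intro antisym INF_lower INF_greatest) (auto simp: sqnorm_scaled_minus_commute[of C x])

lemma minimizer_in_prox:
  assumes "pos_def C" and "a \<in> argmin f"
  shows "a \<in> prox f C a"
proof -
  have "0 \<le> sqnorm_scaled C (w - a)" for w
    using assms(1) unfolding pos_def_def sqnorm_scaled_def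
    by (cases "w - a = 0") (auto intro: less_imp_le)
  then have "f a + ereal 0 \<le> f w + ereal (1/2 * sqnorm_scaled C (w - a))" for w
    by (intro add_mono argmin_le[OF assms(2)]) simp
  then show ?thesis
    by (auto simp: prox_def argmin_def is_arg_min_def not_less)
qed

text \<open>If \<open>f\<close> were identically infinite, every point would be a proximal point. So
  single-valuedness at one point yields a point of finiteness.\<close>

lemma singleton_prox_imp_proper:
  fixes C :: "real^'d^'d"
  assumes "prox f C x = {p}"
  shows "\<exists>z. f z \<noteq> \<infinity>"
proof (rule ccontr)
  assume "\<nexists>z. f z \<noteq> \<infinity>"
  then have "prox f C x = UNIV"
    by (auto simp: prox_def argmin_def is_arg_min_def)
  with assms have "(1 :: real^'d) = 0"
    by (metis UNIV_I singletonD)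
  then show False
    by simp
qed

lemma has_derivative_quadratic_remainder:
  fixes g :: "'a::real_normed_vector \<Rightarrow> 'b::real_normed_vector"
  assumes "bounded_linear g'" and "0 < e"
    and "\<And>y. dist y x < e \<Longrightarrow> norm (g y - g x - g' (y - x)) \<le> K * (norm (y - x))\<^sup>2"
  shows "(g has_derivative g') (at x)"
proof (rule has_derivativeI_sandwich[OF assms(2,1)])
  show "norm (g y - g x - g' (y - x)) / norm (y - x) \<le> K * norm (y - x)"
    if "y \<noteq> x" "dist y x < e" for y
    using assms(3)[OF that(2)] that(1) by (simp add: divide_le_eq power2_eq_square mult.assoc)
  have "((\<lambda>y. K * norm (y - x)) \<longlongrightarrow> K * norm (x - x)) (at x)"
    by (intro tendsto_intros)
  then show "((\<lambda>y. K * norm (y - x)) \<longlongrightarrow> 0) (at x)"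
    by simp
qed

text \<open>Testing the infimum defining the envelope at \<open>y\<close> with the proximal point of \<open>x\<close> gives
  \<open>e y - e x \<le> \<langle>C (x - p x), y - x\<rangle> + \<parallel>y - x\<parallel>\<^sub>C\<^sup>2 / 2\<close>. Exchanging the roles of \<open>x\<close> and \<open>y\<close> gives a
  lower bound with \<open>C (y - p y)\<close> in place of \<open>C (x - p x)\<close>, and the Lipschitz condition makes the
  difference quadratic in \<open>y - x\<close>.\<close>

lemma moreau_env_has_gradient:
  fixes f :: "real^'d \<Rightarrow> ereal"
  assumes sym: "transpose C = C" and ninf: "\<And>\<theta>. f \<theta> \<noteq> -\<infinity>" and fz: "f z \<noteq> \<infinity>"
    and prox: "\<And>y. y \<in> S \<Longrightarrow> p y \<in> prox f C y"
    and lip: "L-lipschitz_on S p" and x: "x \<in> interior S"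
  shows "has_gradient (moreau_env f C) x (C *v (x - p x))"
proof -
  define E where "E = moreau_env f C"
  define e where "e y = real_of_ereal (E y)" for y
  obtain \<rho> where \<rho>: "0 < \<rho>" "ball x \<rho> \<subseteq> S"
    using x by (auto simp: mem_interior)
  have S: "y \<in> S" if "dist y x < \<rho>" for y
    using that \<rho>(2) by (auto simp: dist_commute)
  have xS: "x \<in> S"
    using \<rho> S by simp
  have L: "0 \<le> L"
    using lip by (rule lipschitz_on_nonneg)
  have fin: "\<bar>f (p y)\<bar> \<noteq> \<infinity>" if "y \<in> S" for y
    using prox_finite[OF prox[OF that] fz ninf] .
  have E_eq: "E y = f (p y) + ereal (1/2 * sqnorm_scaled C (y - p y))" if "y \<in> S" for y
    unfolding E_def by (rule moreau_env_eq_prox[OF prox[OF that]])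
  have E_fin: "\<bar>E y\<bar> \<noteq> \<infinity>" if "y \<in> S" for y
    using fin[OF that] by (cases "f (p y)") (auto simp: E_eq[OF that])
  have upper: "e v - e u \<le> (v - u) \<bullet> (C *v (u - p u)) + 1/2 * sqnorm_scaled C (v - u)"
    if "u \<in> S" "v \<in> S" for u v
  proof -
    have "E v \<le> f (p u) + ereal (1/2 * sqnorm_scaled C (v - p u))"
      unfolding E_def moreau_env_def by (rule INF_lower) simp
    then have "e v - e u \<le> 1/2 * sqnorm_scaled C (v - p u) - 1/2 * sqnorm_scaled C (u - p u)"
      using fin[OF that(1)] E_fin[OF that(2)] E_eq[OF that(1)]
      by (cases "f (p u)"; cases "E v") (auto simp: e_def)
    then show ?thesis
      using sqnorm_scaled_add[OF sym, of "u - p u" "v - u"] by (simp add: add_divide_distrib)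
  qed
  define B where "B = onorm ((*v) C)"
  have B: "norm (C *v h) \<le> B * norm h" for h
    unfolding B_def by (rule onorm[OF matrix_vector_mul_bounded_linear])
  have B0: "0 \<le> B"
    unfolding B_def by (rule onorm_pos_le[OF matrix_vector_mul_bounded_linear])
  have inner_le: "\<bar>h \<bullet> (C *v k)\<bar> \<le> B * norm h * norm k" for h k
    using Cauchy_Schwarz_ineq2[of h "C *v k"] mult_left_mono[OF B[of k] norm_ge_zero[of h]]
    by (simp add: mult_ac)
  have rem: "norm (e y - e x - (y - x) \<bullet> (C *v (x - p x))) \<le> (2 * B + B * L) * (norm (y - x))\<^sup>2"
    if "dist y x < \<rho>" for y
  proof -
    define h where "h = y - x"
    define d where "d = p y - p x"
    have "norm d \<le> L * norm h"
      using lipschitz_onD[OF lip S[OF that] xS] by (simp add: d_def h_def dist_norm)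
    then have "B * norm h * norm d \<le> B * norm h * (L * norm h)"
      by (intro mult_left_mono mult_nonneg_nonneg B0 norm_ge_zero)
    then have hd: "\<bar>h \<bullet> (C *v d)\<bar> \<le> B * L * (norm h)\<^sup>2"
      using inner_le[of h d] by (simp add: power2_eq_square mult_ac)
    have hh: "\<bar>sqnorm_scaled C h\<bar> \<le> B * (norm h)\<^sup>2"
      using inner_le[of h h] by (simp add: sqnorm_scaled_def power2_eq_square mult_ac)
    have BL: "0 \<le> B * L * (norm h)\<^sup>2" "0 \<le> B * (norm h)\<^sup>2"
      using B0 L by simp_all
    have up: "e y - e x - h \<bullet> (C *v (x - p x)) \<le> 1/2 * sqnorm_scaled C h"
      using upper[OF xS S[OF that]] by (simp add: h_def)
    have "y - p y = (x - p x) + h - d"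
      by (simp add: h_def d_def)
    then have "h \<bullet> (C *v (y - p y)) = h \<bullet> (C *v (x - p x)) + sqnorm_scaled C h - h \<bullet> (C *v d)"
      by (simp only: matrix_vector_right_distrib matrix_vector_mult_diff_distrib inner_add_right
          inner_diff_right sqnorm_scaled_def)
    moreover have "e x - e y \<le> - (h \<bullet> (C *v (y - p y))) + 1/2 * sqnorm_scaled C h"
      using upper[OF S[OF that] xS]
      by (simp add: h_def sqnorm_scaled_minus_commute[of C x] inner_diff_left)
    ultimately have "e y - e x - h \<bullet> (C *v (x - p x)) \<ge> 1/2 * sqnorm_scaled C h - h \<bullet> (C *v d)"
      by linarith
    then have "\<bar>e y - e x - h \<bullet> (C *v (x - p x))\<bar> \<le> 2 * (B * (norm h)\<^sup>2) + B * L * (norm h)\<^sup>2"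
      using up hd hh BL by linarith
    then show ?thesis
      by (simp add: h_def[symmetric] algebra_simps)
  qed
  have "GDERIV e x :> C *v (x - p x)"
    unfolding gderiv_def
    by (rule has_derivative_quadratic_remainder[OF bounded_linear_inner_left \<rho>(1) rem])
  moreover have "\<forall>\<^sub>F y in nhds x. \<bar>E y\<bar> \<noteq> \<infinity>"
    unfolding eventually_nhds_metric by (intro exI[of _ \<rho>] conjI allI impI \<rho>(1) E_fin S)
  ultimately show ?thesis
    unfolding has_gradient_def e_def E_def by simp
qed

section \<open>The error of the one-step estimator\<close>

text \<open>Strong convexity at the midpoint of \<open>a\<close> and \<open>y\<close> is enough. Letting the weight of \<open>y\<close> tend to
  \<open>0\<close> would improve the constant \<open>m/4\<close> to \<open>m/2\<close>.\<close>

lemma strongly_convex_on_argmin_growth: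
  assumes sc: "strongly_convex_on m S f" and S: "a \<in> S" "y \<in> S"
    and a: "a \<in> argmin f" and fin: "\<bar>f a\<bar> \<noteq> \<infinity>" "\<bar>f y\<bar> \<noteq> \<infinity>"
  shows "f a + ereal (m/4 * (norm (y - a))\<^sup>2) \<le> f y"
proof -
  have "f a \<le> f ((1 - 1/2) *\<^sub>R a + (1/2) *\<^sub>R y)"
    by (rule argmin_le[OF a])
  also have "\<dots> \<le> ereal (1 - 1/2) * f a + ereal (1/2) * f y
                 - ereal (m/2 * (1/2) * (1 - 1/2) * (norm (a - y))\<^sup>2)"
    using sc[unfolded strongly_convex_on_def, rule_format, OF S, of "1/2"] by simp
  finally show ?thesis
    using fin by (cases "f a"; cases "f y") (auto simp: norm_minus_commute[of a])
qed

text \<open>The Lipschitz ball has to contain \<open>x\<close> in its interior, since differentiability at \<open>x\<close> uses the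
  proximal points of all nearby arguments. Strong convexity is used only between \<open>a\<close> and the
  proximal point of \<open>x\<close>, which is why the second ball has radius \<open>L * R\<close>.\<close>

lemma one_step_error_bound:
  fixes f :: "real^'d \<Rightarrow> ereal" and C :: "real^'d^'d"
  assumes pd: "pos_def C" and ninf: "\<And>\<theta>. f \<theta> \<noteq> -\<infinity>" and a: "a \<in> argmin f"
    and x: "norm (x - a) < R"
    and lip: "prox_lipschitz_on L (cball a R) f C"
    and sc: "strongly_convex_on m (cball a (L * R)) f"
    and step: "\<And>v. has_gradient (moreau_env f C) x v \<Longrightarrow> u = x - matrix_inv C *v v"
  shows "m * (norm (u - a))\<^sup>2 \<le> 2 * lambda_max C * (norm (x - a))\<^sup>2"
proof -
  have sym: "transpose C = C"
    using pd by (simp add: pos_def_def)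
  obtain p where prox: "\<And>y. y \<in> cball a R \<Longrightarrow> prox f C y = {p y}"
      and p: "L-lipschitz_on (cball a R) p"
    using lip unfolding prox_lipschitz_on_def by blast
  have L: "0 \<le> L"
    using p by (rule lipschitz_on_nonneg)
  have R: "0 < R"
    using x norm_ge_zero[of "x - a"] by linarith
  have balls: "a \<in> cball a R" "x \<in> cball a R" "x \<in> interior (cball a R)"
    using x R by (auto simp: dist_norm norm_minus_commute)
  obtain z where z: "f z \<noteq> \<infinity>"
    using singleton_prox_imp_proper[OF prox[OF balls(1)]] by blast
  have "has_gradient (moreau_env f C) x (C *v (x - p x))"
    by (rule moreau_env_has_gradient[where S = "cball a R" and L = L and z = z])
      (use sym ninf z prox p balls(3) in auto)
  then have u: "u = p x"
    using step pos_def_matrix_inv_mult[OF pd] by simp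
  have "p a = a"
    using minimizer_in_prox[OF pd a] prox[OF balls(1)] by simp
  then have "dist (p x) a \<le> L * dist x a"
    using lipschitz_onD[OF p balls(2,1)] by simp
  also have "\<dots> \<le> L * R"
    using L x by (intro mult_left_mono) (auto simp: dist_norm)
  finally have px: "p x \<in> cball a (L * R)"
    by (simp add: dist_commute)
  have aL: "a \<in> cball a (L * R)"
    using L R by simp
  have pxp: "p x \<in> prox f C x"
    using prox[OF balls(2)] by simp
  have fin: "\<bar>f a\<bar> \<noteq> \<infinity>" "\<bar>f (p x)\<bar> \<noteq> \<infinity>"
    using argmin_le[OF a, of z] z ninf[of a] prox_finite[OF pxp z ninf] by (auto simp: top_ereal_def)
  have "f a + ereal (m/4 * (norm (p x - a))\<^sup>2) \<le> f (p x)"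
    by (rule strongly_convex_on_argmin_growth[OF sc aL px a fin])
  moreover have "f (p x) + ereal (1/2 * sqnorm_scaled C (p x - x))
      \<le> f a + ereal (1/2 * sqnorm_scaled C (a - x))"
    by (rule prox_le[OF pxp])
  moreover have "0 \<le> sqnorm_scaled C (p x - x)"
    using pd unfolding pos_def_def sqnorm_scaled_def
    by (cases "p x - x = 0") (auto intro: less_imp_le)
  ultimately have "m/4 * (norm (p x - a))\<^sup>2 \<le> 1/2 * sqnorm_scaled C (a - x)"
    using fin by (cases "f a"; cases "f (p x)") simp_all
  also have "\<dots> \<le> 1/2 * (lambda_max C * (norm (x - a))\<^sup>2)"
    using sqnorm_scaled_le_lambda_max[OF sym, of "a - x"] by (simp add: norm_minus_commute)
  finally show ?thesis
    by (simp add: u)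
qed

section \<open>Events of high inner probability\<close>

lemma prob_ge_mono:
  assumes "prob_ge P q E" and "\<And>w. w \<in> space P \<Longrightarrow> E w \<Longrightarrow> F w"
  shows "prob_ge P q F"
proof -
  obtain A where A: "A \<in> sets P" "\<forall>w\<in>A. E w" "q \<le> measure P A"
    using assms(1) unfolding prob_ge_def by (elim bexE conjE)
  then have "\<forall>w\<in>A. F w"
    using assms(2) sets.sets_into_space[OF A(1)] by auto
  then show ?thesis
    using A unfolding prob_ge_def by (intro bexI[of _ A] conjI)
qed

lemma (in prob_space) prob_ge_conj:
  assumes "prob_ge M (1 - a) E" and "prob_ge M (1 - b) F"
  shows "prob_ge M (1 - (a + b)) (\<lambda>w. E w \<and> F w)"
proof -
  obtain A B where A: "A \<in> events" "\<forall>w\<in>A. E w" "1 - a \<le> prob A"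
    and B: "B \<in> events" "\<forall>w\<in>B. F w" "1 - b \<le> prob B"
    using assms unfolding prob_ge_def by (elim bexE conjE)
  have "prob (A \<union> B) = prob A + prob B - prob (A \<inter> B)"
    using A B by (intro measure_Un3) (auto simp: fmeasurable_eq_sets)
  then have "1 - (a + b) \<le> prob (A \<inter> B)"
    using prob_le_1[of "A \<union> B"] A(3) B(3) by linarith
  then show ?thesis
    using A B unfolding prob_ge_def by (intro bexI[of _ "A \<inter> B"]) auto
qed

lemma (in prob_space) whp_conj:
  assumes "whp M E" and "whp M F"
  shows "whp M (\<lambda>n w. E n w \<and> F n w)"
  unfolding whp_def
proof (intro allI impI)
  fix \<epsilon> :: real
  assume "0 < \<epsilon>"
  then have "0 < \<epsilon>/2"
    by simp
  then have "\<forall>\<^sub>F n in sequentially. prob_ge M (1 - \<epsilon>/2) (E n)"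
      "\<forall>\<^sub>F n in sequentially. prob_ge M (1 - \<epsilon>/2) (F n)"
    using assms unfolding whp_def by blast+
  then show "\<forall>\<^sub>F n in sequentially. prob_ge M (1 - \<epsilon>) (\<lambda>w. E n w \<and> F n w)"
    by eventually_elim (use prob_ge_conj[of "\<epsilon>/2" _ "\<epsilon>/2"] in simp)
qed

lemma (in prob_space) AE_imp_whp:
  assumes "\<And>n. AE w in M. E n w"
  shows "whp M E"
proof -
  have "prob_ge M (1 - \<epsilon>) (E n)" if "0 < \<epsilon>" for n \<epsilon>
  proof -
    obtain N where N: "{w \<in> space M. \<not> E n w} \<subseteq> N" "emeasure M N = 0" "N \<in> events"
      using AE_E[OF assms[of n]] .
    have "prob (space M - N) = 1"
      using prob_compl[OF N(3)] N(2) by (simp add: measure_def)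
    then show ?thesis
      using N that unfolding prob_ge_def by (intro bexI[of _ "space M - N"]) auto
  qed
  then show ?thesis
    unfolding whp_def by simp
qed

section \<open>Asymptotic equivalence\<close>

theorem corollary4p2:
  fixes P :: "'w measure"
    and \<Theta> :: "(real^'d) set"
    and f :: "nat \<Rightarrow> 'w \<Rightarrow> real^'d \<Rightarrow> ereal"
    and C :: "nat \<Rightarrow> 'w \<Rightarrow> real^'d^'d"
    and \<theta>hat \<theta>init \<theta>ose :: "nat \<Rightarrow> 'w \<Rightarrow> real^'d"
  assumes "prob_space P"
    and "open \<Theta>"
    and "\<And>n \<theta>. (\<lambda>w. f n w \<theta>) \<in> borel_measurable P"
    and "\<And>n w \<theta>. w \<in> space P \<Longrightarrow> f n w \<theta> \<noteq> -\<infinity>"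
    and "\<And>n w \<theta>. w \<in> space P \<Longrightarrow> \<theta> \<notin> \<Theta> \<Longrightarrow> f n w \<theta> = \<infinity>"
    and "\<And>n. C n \<in> borel_measurable P"
    and "\<And>n w. w \<in> space P \<Longrightarrow> pos_def (C n w)"
    and "\<And>n. \<theta>hat n \<in> borel_measurable P"
    and "\<And>n. \<theta>init n \<in> borel_measurable P"
    and "\<And>n. \<theta>ose n \<in> borel_measurable P"
    and "\<And>n. AE w in P. \<theta>hat n w \<in> argmin (f n w)"
    and "\<And>n. AE w in P. prox (f n w) (C n w) (\<theta>init n w) \<noteq> {}"
    and "sqrt_n_consistent P \<theta>init \<theta>hat"
    and "smallo_P1 P (\<lambda>n w. lambda_max (C n w))"
    and "\<exists>L. \<forall>M. whp P (\<lambda>n w.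
           prox_lipschitz_on L (cball (\<theta>hat n w) (M / sqrt (real n))) (f n w) (C n w))"
    and "\<exists>m>0. \<forall>M. whp P (\<lambda>n w.
           strongly_convex_on m (cball (\<theta>hat n w) (M / sqrt (real n))) (f n w))"
    and "\<And>n w v. w \<in> space P \<Longrightarrow> has_gradient (moreau_env (f n w) (C n w)) (\<theta>init n w) v
           \<Longrightarrow> \<theta>ose n w = \<theta>init n w - matrix_inv (C n w) *v v"
  shows "asymp_equivalent P \<theta>ose \<theta>hat"
proof -
  interpret prob_space P
    by (rule assms(1))
  obtain L where L: "\<forall>M. whp P (\<lambda>n w.
      prox_lipschitz_on L (cball (\<theta>hat n w) (M / sqrt (real n))) (f n w) (C n w))"
    using assms(15) ..
  obtain m where m: "0 < m" and sc: "\<forall>M. whp P (\<lambda>n w.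
      strongly_convex_on m (cball (\<theta>hat n w) (M / sqrt (real n))) (f n w))"
    using assms(16) by (elim exE conjE)
  have "\<forall>\<^sub>F n in sequentially.
      prob_ge P (1 - \<epsilon>) (\<lambda>w. norm (sqrt (real n) * norm (\<theta>ose n w - \<theta>hat n w)) \<le> \<delta>)"
    if \<delta>: "0 < \<delta>" and \<epsilon>: "0 < \<epsilon>" for \<delta> \<epsilon> :: real
  proof -
    have \<epsilon>2: "0 < \<epsilon>/2"
      using \<epsilon> by simp
    obtain K0 where K0: "\<forall>\<^sub>F n in sequentially.
        prob_ge P (1 - \<epsilon>/2) (\<lambda>w. norm (sqrt (real n) *\<^sub>R (\<theta>init n w - \<theta>hat n w)) \<le> K0)"
      using assms(13) \<epsilon>2 unfolding sqrt_n_consistent_def bigO_P1_def by (elim allE impE exE)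
    \<comment> \<open>strictly above \<open>K0\<close>, so that the initial estimator is interior to the ball\<close>
    define K where "K = \<bar>K0\<bar> + 1"
    have K: "0 < K" "K0 < K"
      by (auto simp: K_def)
    \<comment> \<open>chosen so that \<open>2 \<eta> K\<^sup>2 / m = \<delta>\<^sup>2\<close>\<close>
    define \<eta> where "\<eta> = m * \<delta>\<^sup>2 / (2 * K\<^sup>2)"
    have \<eta>: "0 < \<eta>"
      using m \<delta> K by (simp add: \<eta>_def)
    define G where "G n w \<longleftrightarrow>
        ((\<theta>hat n w \<in> argmin (f n w) \<and> norm (lambda_max (C n w)) \<le> \<eta>) \<and>
         prox_lipschitz_on L (cball (\<theta>hat n w) (K / sqrt (real n))) (f n w) (C n w)) \<and>
        strongly_convex_on m (cball (\<theta>hat n w) (L * K / sqrt (real n))) (f n w)" for n w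
    have "whp P (\<lambda>n w. norm (lambda_max (C n w)) \<le> \<eta>)"
      using assms(14) \<eta> unfolding smallo_P1_def by (elim allE impE)
    then have "whp P G"
      unfolding G_def
      by (rule whp_conj[OF whp_conj[OF whp_conj[OF AE_imp_whp[OF assms(11)]] spec[OF L]] spec[OF sc]])
    then have G: "\<forall>\<^sub>F n in sequentially. prob_ge P (1 - \<epsilon>/2) (G n)"
      using \<epsilon>2 unfolding whp_def by (elim allE impE)
    from K0 G eventually_gt_at_top[of 0] show ?thesis
    proof eventually_elim
      case (elim n)
      have sn: "0 < sqrt (real n)" and n: "0 < real n"
        using elim(3) by simp_all
      show ?case
      proof (rule prob_ge_mono)
        show "prob_ge P (1 - \<epsilon>)
            (\<lambda>w. norm (sqrt (real n) *\<^sub>R (\<theta>init n w - \<theta>hat n w)) \<le> K0 \<and> G n w)"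
          using prob_ge_conj[OF elim(1,2)] by simp
      next
        fix w
        assume w: "w \<in> space P"
          and good: "norm (sqrt (real n) *\<^sub>R (\<theta>init n w - \<theta>hat n w)) \<le> K0 \<and> G n w"
        define i where "i = norm (\<theta>init n w - \<theta>hat n w)"
        define o' where "o' = norm (\<theta>ose n w - \<theta>hat n w)"
        have si: "sqrt (real n) * i < K"
          using good K by (simp add: i_def)
        then have i: "i < K / sqrt (real n)"
          using sn by (simp add: pos_less_divide_eq mult.commute)
        have "m * o'\<^sup>2 \<le> 2 * lambda_max (C n w) * i\<^sup>2"
          unfolding i_def o'_def
          using good i assms(17)[OF w] unfolding G_def i_def
          by (intro one_step_error_bound[OF assms(7)[OF w] assms(4)[OF w]]) auto
        also have "\<dots> \<le> 2 * \<eta> * i\<^sup>2"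
          using good by (intro mult_right_mono) (auto simp: G_def)
        finally have "real n * (m * o'\<^sup>2) \<le> real n * (2 * \<eta> * i\<^sup>2)"
          using n by (intro mult_left_mono) auto
        also have "\<dots> = 2 * \<eta> * (sqrt (real n) * i)\<^sup>2"
          by (simp add: power_mult_distrib)
        also have "\<dots> \<le> 2 * \<eta> * K\<^sup>2"
          using si \<eta> by (intro mult_left_mono power_mono) (auto simp: i_def)
        also have "\<dots> = m * \<delta>\<^sup>2"
          using K by (simp add: \<eta>_def)
        finally have "m * (sqrt (real n) * o')\<^sup>2 \<le> m * \<delta>\<^sup>2"
          by (simp add: power_mult_distrib mult_ac)
        then have "(sqrt (real n) * o')\<^sup>2 \<le> \<delta>\<^sup>2"
          using m by (rule mult_left_le_imp_le)
        then have "sqrt (real n) * o' \<le> \<delta>"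
          by (rule power2_le_imp_le) (use \<delta> in simp)
        then show "norm (sqrt (real n) * norm (\<theta>ose n w - \<theta>hat n w)) \<le> \<delta>"
          by (simp add: o'_def)
      qed
    qed
  qed
  then show ?thesis
    unfolding asymp_equivalent_def smallo_P1_def whp_def by simp
qed

end
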